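(* Let $\alpha>-1$ and $\beta>-1$ be real numbers, let $n\ge 1$ be an integer, and let $\{\zeta_{n,i}\}_{i=1}^{n}$ be the set of zeros of the Jacobi polynomial $P_n^{(\alpha,\beta)}$. Then $$\frac1n\sum_{i=1}^{n}f(\zeta_{n,i})\le\frac{(n+\beta)f(1)+(n+\alpha)f(-1)}{2n+\alpha+\beta}$$ for every convex function $f:[-1,1]\to\mathbb{R}$.
   Context: The Jacobi polynomials are defined, for $\alpha,\beta>-1$, by $$P_n^{(\alpha,\beta)}(z)=\frac{(-1)^n}{2^n n!}(1-z)^{-\alpha}(1+z)^{-\beta}\frac{d^n}{dz^n}\left[(1-z)^{n+\alpha}(1+z)^{n+\beta}\right].$$ *)

theory Defs
  imports "HOL-Analysis.Analysis" "HOL-Computational_Algebra.Polynomial"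
begin

definition jacobi_rodrigues :: "nat \<Rightarrow> real \<Rightarrow> real \<Rightarrow> real \<Rightarrow> real" where
  "jacobi_rodrigues n \<alpha> \<beta> z =
     (-1) ^ n / (2 ^ n * fact n) * (1 - z) powr (- \<alpha>) * (1 + z) powr (- \<beta>) *
     (deriv ^^ n) (\<lambda>t. (1 - t) powr (real n + \<alpha>) * (1 + t) powr (real n + \<beta>)) z"

text \<open>
  With real powers, the Rodrigues expression is meaningful only on the open interval $(-1,1)$;
  the Jacobi polynomial is the polynomial that agrees with it there. Existence and uniqueness
  are shown below.
\<close>

definition jacobi_poly :: "nat \<Rightarrow> real \<Rightarrow> real \<Rightarrow> real poly" where
  "jacobi_poly n \<alpha> \<beta> = (THE p. \<forall>z\<in>{-1<..<1}. poly p z = jacobi_rodrigues n \<alpha> \<beta> z)"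

lemma higher_deriv_jacobi_weight:
  fixes a b :: real
  shows "\<exists>q. \<forall>z\<in>{-1<..<1}.
    (deriv ^^ k) (\<lambda>t. (1 - t) powr a * (1 + t) powr b) z =
      (1 - z) powr (a - real k) * (1 + z) powr (b - real k) * poly q z"
proof (induction k)
  case 0
  show ?case by (rule exI[of _ 1]) simp
next
  case (Suc k)
  let ?w = "\<lambda>t::real. (1 - t) powr a * (1 + t) powr b"
  from Suc obtain q where q: "\<And>z. z \<in> {-1<..<1} \<Longrightarrow> (deriv ^^ k) ?w z =
      (1 - z) powr (a - real k) * (1 + z) powr (b - real k) * poly q z" by blast
  define c d where "c = a - real k" and "d = b - real k"
  define r where "r = [:-c, -c:] * q + [:d, -d:] * q + [:1, 0, -1:] * pderiv q"
  show ?case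
  proof (rule exI[of _ r], rule ballI)
    fix z :: real assume z: "z \<in> {-1<..<1}"
    have u: "(1 - z) powr c = (1 - z) powr (c - 1) * (1 - z)"
      and v: "(1 + z) powr d = (1 + z) powr (d - 1) * (1 + z)"
      using z by (auto simp: powr_diff)
    have ev: "eventually (\<lambda>t. t \<in> {-1<..<1::real}) (nhds z)"
      using z by (intro eventually_nhds_in_open) auto
    have "((\<lambda>t. (1 - t) powr c * (1 + t) powr d * poly q t) has_field_derivative
            (1 - z) powr (c - 1) * (1 + z) powr (d - 1) * poly r z) (at z)"
      using z
      by (auto intro!: derivative_eq_intros simp: r_def u v)
         (simp add: algebra_simps)
    then have "deriv (\<lambda>t. (1 - t) powr c * (1 + t) powr d * poly q t) z =
            (1 - z) powr (c - 1) * (1 + z) powr (d - 1) * poly r z"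
      by (rule DERIV_imp_deriv)
    moreover have "deriv ((deriv ^^ k) ?w) z =
        deriv (\<lambda>t. (1 - t) powr c * (1 + t) powr d * poly q t) z"
      by (rule deriv_cong_ev) (auto intro!: eventually_mono[OF ev] simp: q c_def d_def)
    ultimately show "(deriv ^^ Suc k) ?w z =
        (1 - z) powr (a - real (Suc k)) * (1 + z) powr (b - real (Suc k)) * poly r z"
      by (simp add: c_def d_def algebra_simps)
  qed
qed

lemma ex1_jacobi_poly:
  "\<exists>!p. \<forall>z\<in>{-1<..<1}. poly p z = jacobi_rodrigues n \<alpha> \<beta> z"
proof (rule ex_ex1I)
  obtain q where q: "\<And>z. z \<in> {-1<..<1} \<Longrightarrow>
    (deriv ^^ n) (\<lambda>t. (1 - t) powr (real n + \<alpha>) * (1 + t) powr (real n + \<beta>)) z =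
      (1 - z) powr \<alpha> * (1 + z) powr \<beta> * poly q z"
    using higher_deriv_jacobi_weight[of n "real n + \<alpha>" "real n + \<beta>"] by auto
  show "\<exists>p. \<forall>z\<in>{-1<..<1}. poly p z = jacobi_rodrigues n \<alpha> \<beta> z"
  proof (rule exI[of _ "smult ((-1) ^ n / (2 ^ n * fact n)) q"], rule ballI)
    fix z :: real assume z: "z \<in> {-1<..<1}"
    then have "(1 - z) powr (- \<alpha>) * (1 - z) powr \<alpha> = 1"
      and "(1 + z) powr (- \<beta>) * (1 + z) powr \<beta> = 1"
      by (auto simp flip: powr_add)
    then have "(1 - z) powr (- \<alpha>) * (1 + z) powr (- \<beta>) *
        ((1 - z) powr \<alpha> * (1 + z) powr \<beta> * poly q z) = poly q z"
      by algebra
    then show "poly (smult ((-1) ^ n / (2 ^ n * fact n)) q) z = jacobi_rodrigues n \<alpha> \<beta> z"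
      unfolding jacobi_rodrigues_def q[OF z] poly_smult by (simp only: mult.assoc)
  qed
next
  fix p q :: "real poly"
  assume "\<forall>z\<in>{-1<..<1}. poly p z = jacobi_rodrigues n \<alpha> \<beta> z"
    and "\<forall>z\<in>{-1<..<1}. poly q z = jacobi_rodrigues n \<alpha> \<beta> z"
  then have "{-1<..<1} \<subseteq> {z. poly (p - q) z = 0}" by auto
  moreover have "infinite {-1<..<1::real}" by (simp add: infinite_Ioo)
  ultimately have "infinite {z. poly (p - q) z = 0}" using finite_subset by blast
  then have "p - q = 0" using poly_roots_finite by blast
  then show "p = q" by simp
qed

lemma poly_jacobi_poly:
  "z \<in> {-1<..<1} \<Longrightarrow> poly (jacobi_poly n \<alpha> \<beta>) z = jacobi_rodrigues n \<alpha> \<beta> z"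
  using theI'[OF ex1_jacobi_poly[of n \<alpha> \<beta>]] by (simp add: jacobi_poly_def)

end

theory Submission
  imports Defs
begin

text \<open>
  By Rolle's theorem, applied \<open>n\<close> times to \<open>(1 - t)\<^sup>n\<^sup>+\<^sup>\<alpha> (1 + t)\<^sup>n\<^sup>+\<^sup>\<beta>\<close> and its derivatives (the first
  \<open>n - 1\<close> of which vanish at \<open>\<plusminus>1\<close>), the Jacobi polynomial has \<open>n\<close> distinct zeros in \<open>(-1, 1)\<close>. The two
  leading coefficients, followed through the differentiations, show that the mean of the zeros is
  \<open>(\<beta> - \<alpha>) / (2n + \<alpha> + \<beta>)\<close>. Bounding the convex function by its chord on \<open>[-1, 1]\<close> and averaging
  over the zeros gives the inequality.
\<close>

section \<open>Tools: chord bound, sum of simple roots, Rolle's theorem on finite sets\<close>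

text \<open>The point \<open>z\<close> divides [-1, 1] with weight \<open>(1 + z) / 2\<close> at 1.
  The chord is affine in \<open>z\<close>, so its sum depends only on the number of points and their
  sum.\<close>

lemma sum_convex_on_le_chord:
  fixes f :: "real \<Rightarrow> real" and Z :: "real set"
  assumes "convex_on {-1..1} f" and "Z \<subseteq> {-1..1}"
  shows "2 * (\<Sum>z\<in>Z. f z) \<le> (card Z + \<Sum>Z) * f 1 + (card Z - \<Sum>Z) * f (-1)"
proof -
  have "2 * f z \<le> (1 + z) * f 1 + (1 - z) * f (-1)" if "z \<in> Z" for z
  proof -
    have "f ((1 - (1 + z) / 2) *\<^sub>R (-1) + ((1 + z) / 2) *\<^sub>R 1)
        \<le> (1 - (1 + z) / 2) * f (-1) + ((1 + z) / 2) * f 1"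
      using that assms(2) by (intro convex_onD[OF assms(1)]) auto
    then show ?thesis by (simp add: field_simps)
  qed
  then have "(\<Sum>z\<in>Z. 2 * f z) \<le> (\<Sum>z\<in>Z. (1 + z) * f 1 + (1 - z) * f (-1))"
    by (rule sum_mono)
  also have "\<dots> = (card Z + \<Sum>Z) * f 1 + (card Z - \<Sum>Z) * f (-1)"
    by (simp add: sum.distrib sum_subtractf flip: sum_distrib_right)
  finally show ?thesis by (simp add: sum_distrib_left)
qed

text \<open>Using \<open>pCons 0\<close> to shift the coefficients avoids the truncated index \<open>card A - 1\<close>.\<close>

lemma coeff_prod_linear_factors:
  fixes A :: "'a::idom set"
  assumes "finite A"
  shows "degree (\<Prod>z\<in>A. [:- z, 1:]) = card A"
    and "coeff (\<Prod>z\<in>A. [:- z, 1:]) (card A) = 1"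
    and "coeff (pCons 0 (\<Prod>z\<in>A. [:- z, 1:])) (card A) = - \<Sum>A"
proof -
  \<comment> \<open>Stated for every set, because the induction below needs the leading coefficient
    at the smaller set.\<close>
  have deg: "degree (\<Prod>z\<in>A. [:- z, 1:]) = card A" for A :: "'a set"
    by (subst degree_prod_eq_sum_degree) auto
  have lead: "coeff (\<Prod>z\<in>A. [:- z, 1:]) (card A) = 1" for A :: "'a set"
    using lead_coeff_prod[of "\<lambda>z. [:- z, 1:]" A] by (simp add: deg)
  show "degree (\<Prod>z\<in>A. [:- z, 1:]) = card A" "coeff (\<Prod>z\<in>A. [:- z, 1:]) (card A) = 1"
    by (fact deg lead)+
  show "coeff (pCons 0 (\<Prod>z\<in>A. [:- z, 1:])) (card A) = - \<Sum>A"
    using assms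
  proof (induction A)
    case (insert a A)
    let ?P = "\<Prod>z\<in>A. [:- z, 1:]"
    have "coeff (pCons 0 ([:- a, 1:] * ?P)) (Suc (card A))
        = coeff (pCons 0 ?P) (card A) - a * coeff ?P (card A)" by simp
    then show ?case using insert lead[of A] by (simp del: mult_pCons_left)
  qed simp
qed

text \<open>With as many distinct roots as its degree, \<open>p\<close> is its leading coefficient
  times the product of the linear factors: both sides agree in degree, leading coefficient and at
  all the roots. Vieta's formula follows.\<close>

lemma sum_roots:
  fixes p :: "'a::idom poly"
  assumes "p \<noteq> 0" and "card {z. poly p z = 0} = degree p"
  shows "coeff (pCons 0 p) (degree p) = - (lead_coeff p * (\<Sum>z | poly p z = 0. z))"
proof -
  let ?Z = "{z. poly p z = 0}"
  have fin: "finite ?Z" using assms(1) by (rule poly_roots_finite)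
  note P = coeff_prod_linear_factors[OF fin, unfolded assms(2)]
  have "p = smult (lead_coeff p) (\<Prod>z\<in>?Z. [:- z, 1:])"
  proof (rule poly_eqI_degree_lead_coeff[where n = "degree p" and A = ?Z])
    show "poly p z = poly (smult (lead_coeff p) (\<Prod>z\<in>?Z. [:- z, 1:])) z" if "z \<in> ?Z" for z
      using that fin by (auto simp: poly_prod)
  qed (use P assms(2) in \<open>auto simp: degree_smult_eq\<close>)
  then have "pCons 0 p = smult (lead_coeff p) (pCons 0 (\<Prod>z\<in>?Z. [:- z, 1:]))" by simp
  then have "coeff (pCons 0 p) (degree p) =
      coeff (smult (lead_coeff p) (pCons 0 (\<Prod>z\<in>?Z. [:- z, 1:]))) (degree p)" by (rule arg_cong)
  then show ?thesis by (simp only: coeff_smult P(3) mult_minus_right)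
qed

text \<open>Points are added in increasing order, and Rolle's theorem gives one new zero between
  \<open>Max A\<close> and the added point. The clause \<open>\<exists>x\<in>A. y < x\<close> keeps
  the earlier zeros below \<open>Max A\<close>, so the new one is distinct from them.\<close>

lemma Rolle_finite:
  fixes g g' :: "real \<Rightarrow> real"
  assumes cont: "continuous_on {u..v} g"
    and deriv: "\<And>x. x \<in> {u<..<v} \<Longrightarrow> (g has_real_derivative g' x) (at x)"
    and "finite A" "A \<subseteq> {u..v}" "\<And>x. x \<in> A \<Longrightarrow> g x = 0"
  shows "\<exists>B\<subseteq>{u<..<v}. finite B \<and> card A \<le> Suc (card B) \<and> (\<forall>y\<in>B. g' y = 0 \<and> (\<exists>x\<in>A. y < x))"
  using assms(3-)
proof (induction A rule: finite_linorder_max_induct)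
  case empty
  show ?case by (intro exI[of _ "{}"]) auto
next
  case (insert b A)
  then obtain B where B: "B \<subseteq> {u<..<v}" "finite B" "card A \<le> Suc (card B)"
      "\<And>y. y \<in> B \<Longrightarrow> g' y = 0" "\<And>y. y \<in> B \<Longrightarrow> \<exists>x\<in>A. y < x"
    by auto
  show ?case
  proof (cases "A = {}")
    case True
    then show ?thesis by (intro exI[of _ "{}"]) auto
  next
    case False
    define m where "m = Max A"
    have m: "m \<in> A" "\<And>x. x \<in> A \<Longrightarrow> x \<le> m"
      using False insert.hyps by (auto simp: m_def)
    have "m < b" using insert.hyps m by auto
    have sub: "u \<le> m" "b \<le> v" using insert.prems m by auto
    have "\<exists>z>m. z < b \<and> (g has_real_derivative 0) (at z)"
    proof (rule Rolle)
      show "continuous_on {m..b} g" using cont sub by (rule_tac continuous_on_subset) auto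
      show "g differentiable (at x)" if "m < x" "x < b" for x
        using deriv[of x] that sub by (auto simp: real_differentiable_def)
    qed (use \<open>m < b\<close> m insert.prems in auto)
    then obtain z where z: "m < z" "z < b" "(g has_real_derivative 0) (at z)" by blast
    have zuv: "z \<in> {u<..<v}" using z sub by auto
    have "g' z = 0" using DERIV_unique[OF z(3) deriv[OF zuv]] by simp
    moreover have "z \<notin> B" using B(5) m z(1) by force
    moreover have "b \<notin> A" using insert.hyps by auto
    ultimately show ?thesis
      using B zuv z insert.hyps by (intro exI[of _ "insert z B"]) auto
  qed
qed

section \<open>Derivatives of the weight (1 - t)^a (1 + t)^b and their coefficients\<close>

text \<open>The polynomial factor left in the k-th derivative of the weight once (1 - t)^(a-k) (1 +
  t)^(b-k) is taken out. The recursion is the product rule, kept explicit so that coefficients can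
  be followed through it.\<close>

fun weight_poly :: "real \<Rightarrow> real \<Rightarrow> nat \<Rightarrow> real poly" where
  "weight_poly a b 0 = 1"
| "weight_poly a b (Suc k) =
     [:(b - real k) - (a - real k), - ((a - real k) + (b - real k)):] * weight_poly a b k
     + [:1, 0, -1:] * pderiv (weight_poly a b k)"

declare weight_poly.simps(2) [simp del]

lemma has_derivative_weight_poly:
  assumes "z \<in> {-1<..<1::real}"
  shows "((\<lambda>t. (1 - t) powr (a - real k) * (1 + t) powr (b - real k) * poly (weight_poly a b k) t)
    has_real_derivative
      (1 - z) powr (a - real (Suc k)) * (1 + z) powr (b - real (Suc k)) *
        poly (weight_poly a b (Suc k)) z) (at z)"
proof -
  define c d q where cdq: "c = a - real k" "d = b - real k" "q = weight_poly a b k"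
  have uv: "(1 - z) powr c = (1 - z) powr (c - 1) * (1 - z)"
    "(1 + z) powr d = (1 + z) powr (d - 1) * (1 + z)"
    using assms by (auto simp: powr_diff)
  have e: "a - real (Suc k) = c - 1" "b - real (Suc k) = d - 1" by (simp_all add: cdq)
  show ?thesis
    unfolding e weight_poly.simps unfolding cdq[symmetric] using assms
    by (auto intro!: derivative_eq_intros simp: uv) (simp add: algebra_simps)
qed

lemma higher_deriv_weight:
  assumes "z \<in> {-1<..<1::real}"
  shows "(deriv ^^ k) (\<lambda>t. (1 - t) powr a * (1 + t) powr b) z =
    (1 - z) powr (a - real k) * (1 + z) powr (b - real k) * poly (weight_poly a b k) z"
  using assms
proof (induction k arbitrary: z)
  case (Suc k)
  have "eventually (\<lambda>t. t \<in> {-1<..<1::real}) (nhds z)"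
    using Suc.prems by (intro eventually_nhds_in_open) auto
  then have "deriv ((deriv ^^ k) (\<lambda>t. (1 - t) powr a * (1 + t) powr b)) z =
      deriv (\<lambda>t. (1 - t) powr (a - real k) * (1 + t) powr (b - real k)
        * poly (weight_poly a b k) t) z"
    by (intro deriv_cong_ev) (auto elim!: eventually_mono simp: Suc.IH)
  also have "\<dots> = (1 - z) powr (a - real (Suc k)) * (1 + z) powr (b - real (Suc k)) *
      poly (weight_poly a b (Suc k)) z"
    by (intro DERIV_imp_deriv has_derivative_weight_poly Suc.prems)
  finally show ?case by simp
qed simp

lemma degree_weight_poly_le: "degree (weight_poly a b k) \<le> k"
proof (induction k)
  case (Suc k)
  have "degree ([:x, y:] * weight_poly a b k) \<le> Suc k" for x y
    using degree_mult_le[of "[:x, y:]" "weight_poly a b k"] Suc degree_pCons_le[of x "[:y:]"]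
    by simp
  moreover have "degree ([:1, 0, -1:] * pderiv (weight_poly a b k)) \<le> Suc k"
  \<comment> \<open>Truncated subtraction in \<open>degree_pderiv\<close> would give only the bound
    2 for a constant, too weak when \<open>k\<close> is 0.\<close>
  proof (cases "degree (weight_poly a b k) = 0")
    case True
    then have "pderiv (weight_poly a b k) = 0" by (simp add: pderiv_eq_0_iff)
    then show ?thesis by simp
  next
    case False
    then show ?thesis
      using degree_mult_le[of "[:1, 0, -1:]" "pderiv (weight_poly a b k)"] Suc
      by (simp add: degree_pderiv del: mult_pCons_left)
  qed
  ultimately show ?case by (simp only: weight_poly.simps degree_add_le)
qed simp

lemma coeff_weight_poly_Suc:
  "coeff (weight_poly a b (Suc k)) (Suc k) = - (a + b - real k) * coeff (weight_poly a b k) k"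
  "coeff (weight_poly a b (Suc k)) k =
    (b - a) * coeff (weight_poly a b k) k
    - (a + b - real k - 1) * coeff (pCons 0 (weight_poly a b k)) k"
proof -
  define q where "q = weight_poly a b k"
  have high: "coeff q (k + Suc i) = 0" for i
    using degree_weight_poly_le[of a b k] by (intro coeff_eq_0) (auto simp: q_def)
  show "coeff (weight_poly a b (Suc k)) (Suc k) = - (a + b - real k) * coeff (weight_poly a b k) k"
    using high[of 0] high[of 1] unfolding weight_poly.simps q_def[symmetric]
    by (cases k) (simp_all add: coeff_pCons coeff_pderiv algebra_simps split: nat.splits)
  show "coeff (weight_poly a b (Suc k)) k =
      (b - a) * coeff (weight_poly a b k) k
      - (a + b - real k - 1) * coeff (pCons 0 (weight_poly a b k)) k"
    using high[of 0] high[of 1] unfolding weight_poly.simps q_def[symmetric]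
    by (cases k) (simp_all add: coeff_pCons coeff_pderiv algebra_simps split: nat.splits)
qed

text \<open>The ratio of the two top coefficients, cleared of denominators. The induction step rests
  on (a + b) + k (a + b - k - 1) = (k + 1) (a + b - k).\<close>

lemma coeff_weight_poly:
  "(a + b) * coeff (pCons 0 (weight_poly a b k)) k = (a - b) * real k * coeff (weight_poly a b k) k"
proof (induction k)
  case (Suc k)
  let ?A = "coeff (weight_poly a b k) k" and ?B = "coeff (pCons 0 (weight_poly a b k)) k"
  have "(a + b) * coeff (weight_poly a b (Suc k)) k
      = (a + b) * (b - a) * ?A - (a + b - real k - 1) * ((a + b) * ?B)"
    unfolding coeff_weight_poly_Suc by (simp add: algebra_simps)
  also have "\<dots> = (a - b) * real (Suc k) * (- (a + b - real k) * ?A)"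
    unfolding Suc by (simp add: algebra_simps)
  finally show ?case by (simp add: coeff_weight_poly_Suc)
qed simp

text \<open>The coefficient is the product of the factors -(a + b - j) for j < k, all negative
  here.\<close>

lemma coeff_weight_poly_neq_0:
  assumes "real k < a + b + 1"
  shows "coeff (weight_poly a b k) k \<noteq> 0"
  using assms by (induction k) (auto simp: coeff_weight_poly_Suc)

section \<open>Location and sum of the zeros\<close>

text \<open>Each differentiation gains a zero: k interior zeros and the two endpoints make k + 2
  points, between which Rolle's theorem finds k + 1 zeros.\<close>

lemma card_roots_weight_poly_ge:
  assumes "real k < a + 1" "real k < b + 1" "real k < a + b + 1"
  shows "k \<le> card {z\<in>{-1<..<1}. poly (weight_poly a b k) z = 0}"
  using assms
proof (induction k)
  case (Suc k)
  let ?w = "\<lambda>k t. (1 - t) powr (a - real k) * (1 + t) powr (b - real k) * poly (weight_poly a b k) t"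
  let ?Z = "\<lambda>k. {z\<in>{-1<..<1}. poly (weight_poly a b k) z = 0}"
  have nz: "weight_poly a b j \<noteq> 0" if "j \<le> Suc k" for j
    using coeff_weight_poly_neq_0[of j a b] that Suc.prems by auto
  have fin: "finite (?Z j)" if "j \<le> Suc k" for j
    using poly_roots_finite[OF nz[OF that]] by (rule finite_subset[rotated]) auto
  \<comment> \<open>The hypotheses at \<open>Suc k\<close> make both exponents
    \<open>a - real k\<close> and \<open>b - real k\<close> positive, as continuity at the endpoints
    requires.\<close>
  have cont: "continuous_on {-1..1} (?w k)"
    using Suc.prems by (intro continuous_intros continuous_on_powr') auto
  have "\<exists>B\<subseteq>{-1<..<1}. finite B \<and> card (insert (-1) (insert 1 (?Z k))) \<le> Suc (card B) \<and>
      (\<forall>y\<in>B. ?w (Suc k) y = 0 \<and> (\<exists>x\<in>insert (-1) (insert 1 (?Z k)). y < x))"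
    using fin[of k]
    by (intro Rolle_finite[where g = "?w k" and g' = "?w (Suc k)", OF cont has_derivative_weight_poly])
      auto
  then obtain B where B: "B \<subseteq> {-1<..<1}" "card (insert (-1) (insert 1 (?Z k))) \<le> Suc (card B)"
      "\<And>y. y \<in> B \<Longrightarrow> ?w (Suc k) y = 0"
    by blast
  \<comment> \<open>The power factors do not vanish inside the interval, so the zeros come from the
    polynomial.\<close>
  have "B \<subseteq> ?Z (Suc k)"
  proof
    fix y assume "y \<in> B"
    then have "y \<in> {-1<..<1}" "?w (Suc k) y = 0" using B by blast+
    then show "y \<in> ?Z (Suc k)" by auto
  qed
  then have "card B \<le> card (?Z (Suc k))" using fin[of "Suc k"] by (intro card_mono) auto
  moreover have "k \<le> card (?Z k)" using Suc by simp
  moreover have "card (insert (-1) (insert 1 (?Z k))) = Suc (Suc (card (?Z k)))"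
    using fin[of k] by simp
  ultimately show ?case using B(2) by linarith
qed simp

text \<open>The n zeros found by Rolle's theorem exhaust the degree, so there are no others;
  \<open>sum_roots\<close> and the coefficient ratio then give their sum.\<close>

lemma roots_weight_poly:
  fixes a b :: real
  assumes "real n < a + 1" "real n < b + 1" "real n < a + b + 1"
  defines "Z \<equiv> {z. poly (weight_poly a b n) z = 0}"
  shows "Z \<subseteq> {-1<..<1}" and "card Z = n" and "(a + b) * \<Sum>Z = (b - a) * real n"
proof -
  let ?q = "weight_poly a b n"
  have lc: "coeff ?q n \<noteq> 0" using coeff_weight_poly_neq_0 assms by blast
  then have nz: "?q \<noteq> 0" by auto
  have deg: "degree ?q = n"
    using lc degree_weight_poly_le[of a b n] by (intro antisym le_degree) auto
  have fin: "finite Z" unfolding Z_def using nz by (rule poly_roots_finite)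
  have le: "card Z \<le> n"
    unfolding Z_def using card_poly_roots_bound[OF nz] deg by simp
  have ge: "n \<le> card {z\<in>{-1<..<1}. poly ?q z = 0}"
    using assms by (intro card_roots_weight_poly_ge)
  have "{z\<in>{-1<..<1}. poly ?q z = 0} \<subseteq> Z" by (auto simp only: Z_def)
  then have eq: "{z\<in>{-1<..<1}. poly ?q z = 0} = Z"
    using fin le ge by (metis card_seteq order_trans)
  show "Z \<subseteq> {-1<..<1}" unfolding eq[symmetric] by (rule Collect_restrict)
  show card: "card Z = n" using le ge unfolding eq by (rule antisym)
  have "coeff (pCons 0 ?q) n = - (coeff ?q n * \<Sum>Z)"
    using sum_roots[OF nz] card deg by (simp add: Z_def)
  then have "coeff ?q n * ((a + b) * \<Sum>Z) = - ((a + b) * coeff (pCons 0 ?q) n)" by simp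
  also have "\<dots> = coeff ?q n * ((b - a) * real n)"
    unfolding coeff_weight_poly by (simp add: algebra_simps)
  finally have "coeff ?q n * ((a + b) * \<Sum>Z) = coeff ?q n * ((b - a) * real n)" .
  then show "(a + b) * \<Sum>Z = (b - a) * real n" using lc by simp
qed

section \<open>Transfer to Jacobi polynomials and conclusion\<close>

lemma jacobi_poly_eq:
  "jacobi_poly n \<alpha> \<beta> =
    smult ((-1) ^ n / (2 ^ n * fact n)) (weight_poly (real n + \<alpha>) (real n + \<beta>) n)"
  unfolding jacobi_poly_def
proof (rule the1_equality[OF ex1_jacobi_poly], rule ballI)
  fix z :: real assume z: "z \<in> {-1<..<1}"
  then have "(1 - z) powr (- \<alpha>) * (1 - z) powr \<alpha> = 1" "(1 + z) powr (- \<beta>) * (1 + z) powr \<beta> = 1"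
    by (auto simp flip: powr_add)
  then have "(1 - z) powr (- \<alpha>) * (1 + z) powr (- \<beta>) * ((1 - z) powr \<alpha> * (1 + z) powr \<beta> * x) = x" for x
    by algebra
  then show "poly (smult ((-1) ^ n / (2 ^ n * fact n)) (weight_poly (real n + \<alpha>) (real n + \<beta>) n)) z
      = jacobi_rodrigues n \<alpha> \<beta> z"
    unfolding jacobi_rodrigues_def higher_deriv_weight[OF z] poly_smult add_diff_cancel_left'
    by (simp only: mult.assoc)
qed

theorem theorem5:
  fixes \<alpha> \<beta> :: real and n :: nat and f :: "real \<Rightarrow> real"
  assumes "\<alpha> > -1" and "\<beta> > -1" and "n \<ge> 1"
    and "convex_on {-1..1} f"
  shows "1 / real n * (\<Sum>\<zeta> | poly (jacobi_poly n \<alpha> \<beta>) \<zeta> = 0. f \<zeta>)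
      \<le> ((real n + \<beta>) * f 1 + (real n + \<alpha>) * f (-1)) / (2 * real n + \<alpha> + \<beta>)"
proof -
  let ?a = "real n + \<alpha>" and ?b = "real n + \<beta>"
  define Z where "Z = {z. poly (jacobi_poly n \<alpha> \<beta>) z = 0}"
  define s where "s = 2 * real n + \<alpha> + \<beta>"
  have n: "real n \<ge> 1" and s: "s > 0" using assms by (auto simp: s_def)
  have Z: "Z = {z. poly (weight_poly ?a ?b n) z = 0}"
    by (simp add: Z_def jacobi_poly_eq)
  \<comment> \<open>The third inequality amounts to n + \<alpha> + \<beta> + 1 > 0, which follows
    from \<alpha> + \<beta> > -2 and n \<ge> 1.\<close>
  have hyps: "real n < ?a + 1" "real n < ?b + 1" "real n < ?a + ?b + 1"
    using assms n by linarith+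
  have sum: "s * \<Sum>Z = (\<beta> - \<alpha>) * real n" and card: "card Z = n" and "Z \<subseteq> {-1..1}"
    using roots_weight_poly[OF hyps] by (force simp: Z s_def algebra_simps)+
  then have "2 * (\<Sum>z\<in>Z. f z) \<le> (real n + \<Sum>Z) * f 1 + (real n - \<Sum>Z) * f (-1)"
    using sum_convex_on_le_chord[OF assms(4)] by metis
  then have "s * (2 * (\<Sum>z\<in>Z. f z)) \<le> s * ((real n + \<Sum>Z) * f 1 + (real n - \<Sum>Z) * f (-1))"
    using s by (intro mult_left_mono) auto
  also have "\<dots> = (s * real n + s * \<Sum>Z) * f 1 + (s * real n - s * \<Sum>Z) * f (-1)"
    by (simp add: algebra_simps)
  \<comment> \<open>Here s + (\<beta> - \<alpha>) = 2 (n + \<beta>) and s - (\<beta> - \<alpha>) = 2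
    (n + \<alpha>).\<close>
  also have "\<dots> = 2 * (real n * (?b * f 1 + ?a * f (-1)))"
    unfolding sum by (simp add: s_def algebra_simps)
  finally have "(\<Sum>z\<in>Z. f z) / real n \<le> (?b * f 1 + ?a * f (-1)) / s"
    using s n by (simp add: divide_simps mult.commute)
  then show ?thesis by (simp flip: Z_def s_def)
qed

end
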